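(* For all positive integers $r,k,n,m$ with $r\geq k$, $$\mathrm{tc}_{r,k}(K_{n,m}) \leq \begin{cases} r-k+1, & \text{if } k\geq r/2,\\ 2r-3k+1, & \text{if } r/2>k\geq 2r/5,\\ 2r-3k+2, & \text{otherwise.}\end{cases}$$
   Context: For integers $r\geq k\geq 1$, an $(r,k)$-colouring of a graph $G$ is a function $\varphi:E(G)\to\binom{[r]}{k}$, assigning to each edge a set of exactly $k$ colours from $[r]=\{1,\dots,r\}$. A subgraph $H\subseteq G$ is monochromatic if there is a colour $i$ belonging to $\varphi(e)$ for every $e\in E(H)$. For an $(r,k)$-colouring $\varphi$ of $G$, $\mathrm{tc}(G,\varphi)$ is the minimum number of monochromatic trees (not necessarily of the same colour; a single vertex counts as a tree) whose union covers $V(G)$. The tree cover number $\mathrm{tc}_{r,k}(G)$ is the minimum $m$ such that every $(r,k)$-colouring $\varphi$ of $E(G)$ satisfies $\mathrm{tc}(G,\varphi)\leq m$. $K_{n,m}$ is the complete bipartite graph with parts of sizes $n$ and $m$. *)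

theory Defs
  imports Complex_Main
begin

text \<open>
  A graph is a pair of a vertex set and a set of two-element edges. The digraph-based notion of a
  tree in the AFP entry Graph-Theory is not used: there a symmetric digraph with at least one edge
  contains a directed cycle \<open>a, b, a\<close>, hence is never a tree.
\<close>

type_synonym 'a ugraph = "'a set \<times> 'a set set"

abbreviation vertices :: "'a ugraph \<Rightarrow> 'a set" where
  "vertices \<equiv> fst"

abbreviation edges :: "'a ugraph \<Rightarrow> 'a set set" where
  "edges \<equiv> snd"

definition simple_graph :: "'a ugraph \<Rightarrow> bool" where
  "simple_graph G \<longleftrightarrow> finite (vertices G) \<and> (\<forall>e\<in>edges G. e \<subseteq> vertices G \<and> card e = 2)"

definition is_subgraph :: "'a ugraph \<Rightarrow> 'a ugraph \<Rightarrow> bool" where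
  "is_subgraph H G \<longleftrightarrow> simple_graph H \<and> vertices H \<subseteq> vertices G \<and> edges H \<subseteq> edges G"

definition walk :: "'a ugraph \<Rightarrow> 'a list \<Rightarrow> bool" where
  "walk G xs \<longleftrightarrow> xs \<noteq> [] \<and> set xs \<subseteq> vertices G \<and> successively (\<lambda>u v. {u, v} \<in> edges G) xs"

definition connected_graph :: "'a ugraph \<Rightarrow> bool" where
  "connected_graph G \<longleftrightarrow> vertices G \<noteq> {} \<and>
     (\<forall>u\<in>vertices G. \<forall>v\<in>vertices G. \<exists>xs. walk G xs \<and> hd xs = u \<and> last xs = v)"

definition cycle_in :: "'a ugraph \<Rightarrow> 'a list \<Rightarrow> bool" where
  "cycle_in G xs \<longleftrightarrow> walk G xs \<and> distinct xs \<and> length xs \<ge> 3 \<and> {last xs, hd xs} \<in> edges G"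

definition tree_graph :: "'a ugraph \<Rightarrow> bool" where
  "tree_graph T \<longleftrightarrow> simple_graph T \<and> connected_graph T \<and> (\<nexists>xs. cycle_in T xs)"

text \<open>Only the values of a colouring on the edges of \<open>G\<close> matter.\<close>

definition is_colouring :: "nat \<Rightarrow> nat \<Rightarrow> 'a ugraph \<Rightarrow> ('a set \<Rightarrow> nat set) \<Rightarrow> bool" where
  "is_colouring r k G \<phi> \<longleftrightarrow> (\<forall>e\<in>edges G. \<phi> e \<subseteq> {1..r} \<and> card (\<phi> e) = k)"

text \<open>
  The colour \<open>i\<close> need not be restricted to \<open>{1..r}\<close>: this is automatic if \<open>H\<close> has an edge, and if
  \<open>H\<close> has no edge every colour works.
\<close>

definition monochromatic :: "('a set \<Rightarrow> nat set) \<Rightarrow> 'a ugraph \<Rightarrow> bool" where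
  "monochromatic \<phi> H \<longleftrightarrow> (\<exists>i. \<forall>e\<in>edges H. i \<in> \<phi> e)"

definition mono_tree_cover ::
  "'a ugraph \<Rightarrow> ('a set \<Rightarrow> nat set) \<Rightarrow> 'a ugraph set \<Rightarrow> bool" where
  "mono_tree_cover G \<phi> F \<longleftrightarrow> finite F \<and>
     (\<forall>T\<in>F. is_subgraph T G \<and> tree_graph T \<and> monochromatic \<phi> T) \<and>
     (\<Union>T\<in>F. vertices T) = vertices G"

definition tc :: "'a ugraph \<Rightarrow> ('a set \<Rightarrow> nat set) \<Rightarrow> nat" where
  "tc G \<phi> = (LEAST m. \<exists>F. mono_tree_cover G \<phi> F \<and> card F = m)"

definition tree_cover_number :: "nat \<Rightarrow> nat \<Rightarrow> 'a ugraph \<Rightarrow> nat" where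
  "tree_cover_number r k G = (LEAST m. \<forall>\<phi>. is_colouring r k G \<phi> \<longrightarrow> tc G \<phi> \<le> m)"

definition complete_bipartite :: "nat \<Rightarrow> nat \<Rightarrow> (nat + nat) ugraph" where
  "complete_bipartite n m = ({..<n} <+> {..<m}, {{Inl i, Inr j} | i j. i < n \<and> j < m})"

text \<open>Both minima above are taken over nonempty sets whenever \<open>G\<close> is a finite simple graph.\<close>

lemma tree_graph_singleton: "tree_graph ({v}, {})"
proof -
  have "walk ({v}, {}) [v]"
    by (simp add: walk_def)
  then have "connected_graph ({v}, {})"
    unfolding connected_graph_def by (auto intro: exI[of _ "[v]"])
  then show ?thesis
    by (simp add: tree_graph_def simple_graph_def cycle_in_def)
qed

lemma ex_mono_tree_cover:
  assumes "simple_graph G"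
  shows "\<exists>F. mono_tree_cover G \<phi> F \<and> card F = card (vertices G)"
proof (intro exI conjI)
  let ?F = "(\<lambda>v. ({v}, {})) ` vertices G"
  show "mono_tree_cover G \<phi> ?F"
    using assms by (auto simp: mono_tree_cover_def tree_graph_singleton is_subgraph_def
        simple_graph_def monochromatic_def)
  show "card ?F = card (vertices G)"
    by (rule card_image) (simp add: inj_on_def)
qed

lemma tc_attained:
  assumes "simple_graph G"
  shows "\<exists>F. mono_tree_cover G \<phi> F \<and> card F = tc G \<phi>"
  unfolding tc_def using ex_mono_tree_cover[OF assms, of \<phi>] by (rule LeastI)

lemma tc_le_card_vertices:
  assumes "simple_graph G"
  shows "tc G \<phi> \<le> card (vertices G)"
  unfolding tc_def using ex_mono_tree_cover[OF assms, of \<phi>] by (rule Least_le)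

lemma tc_le_tree_cover_number:
  assumes "simple_graph G" and "is_colouring r k G \<phi>"
  shows "tc G \<phi> \<le> tree_cover_number r k G"
proof -
  have "\<forall>\<phi>. is_colouring r k G \<phi> \<longrightarrow> tc G \<phi> \<le> tree_cover_number r k G"
    unfolding tree_cover_number_def
    by (rule LeastI[of _ "card (vertices G)"]) (use tc_le_card_vertices[OF assms(1)] in blast)
  then show ?thesis
    using assms(2) by blast
qed

lemma simple_graph_complete_bipartite: "simple_graph (complete_bipartite n m)"
  by (auto simp: simple_graph_def complete_bipartite_def)

end

theory Submission
  imports Defs
begin

text \<open>
  For an edge \<open>uv\<close> take \<open>r - k + 1\<close> colours at \<open>u\<close> and at \<open>v\<close>: their components cover everything, and
  colours connecting \<open>u\<close> to \<open>v\<close> count only once, which gives \<open>2r - 3k + 2\<close> for \<open>2k \<le> r\<close> and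
  \<open>r - k + 1\<close> for \<open>2k > r\<close>. If one component cannot be saved, then every monochromatic component is
  complete bipartite in its colour, and every \<open>k\<close>-set disjoint from a colour set seen at a vertex is
  also seen there. For \<open>2k < r\<close> connectivity of the Kneser graph then shows all \<open>k\<close>-sets at every
  vertex, which produces three pairwise disjoint \<open>k\<close>-sets, hence \<open>3k \<le> r\<close>; but \<open>5k \<ge> 2r\<close> forces
  \<open>3k > r\<close>.
\<close>

section \<open>Spanning trees of monochromatic components\<close>

lemma walk_mono:
  assumes "walk G xs" "vertices G \<subseteq> vertices H" "edges G \<subseteq> edges H"
  shows "walk H xs"
  using assms unfolding walk_def by (auto elim!: successively_mono)

lemma walk_snoc:
  assumes "walk G xs" "{last xs, y} \<in> edges G" "y \<in> vertices G"
  shows "walk G (xs @ [y])"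
  using assms unfolding walk_def by (auto simp: successively_append_iff)

lemma walk_Cons:
  assumes "walk G xs" "{y, hd xs} \<in> edges G" "y \<in> vertices G"
  shows "walk G (y # xs)"
  using assms unfolding walk_def by (cases xs) auto

text \<open>The cyclic predecessor and successor of \<open>y\<close> differ because a cycle has at
  least three distinct vertices. Hence a newly attached leaf lies on no cycle.\<close>

lemma cycle_in_two_neighbours:
  assumes "cycle_in G xs" "y \<in> set xs"
  obtains a b where "a \<noteq> b" "{a, y} \<in> edges G" "{b, y} \<in> edges G"
proof -
  let ?E = "\<lambda>u v. {u, v} \<in> edges G"
  have sym: "{u, v} \<in> edges G \<Longrightarrow> {v, u} \<in> edges G" for u v
    by (simp add: insert_commute)
  obtain ps qs where xs: "xs = ps @ y # qs"
    using assms(2) by (auto simp: in_set_conv_decomp)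
  have succ: "successively ?E (ps @ y # qs)" and dist: "distinct (ps @ y # qs)"
    and len: "length (ps @ y # qs) \<ge> 3" and closing: "?E (last (ps @ y # qs)) (hd (ps @ y # qs))"
    using assms(1) by (simp_all add: cycle_in_def walk_def xs)
  show ?thesis
  proof (cases ps rule: rev_cases)
    case Nil
    then obtain b qs' where qs: "qs = b # qs'" "qs' \<noteq> []"
      using len by (cases qs) (auto simp: Suc_le_eq)
    have "last qs' \<noteq> b"
      using dist qs by auto
    moreover have "?E (last qs') y" "?E y b"
      using succ closing Nil qs by simp_all
    ultimately show ?thesis
      using that sym by blast
  next
    case (snoc ps' a)
    then have ay: "?E a y"
      using succ by (simp add: successively_append_iff)
    show ?thesis
    proof (cases qs)
      case Nil
      have ne: "ps' \<noteq> []"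
        using len snoc Nil by auto
      then have "a \<noteq> hd ps'"
        using dist snoc by auto
      moreover have "?E y (hd ps')"
        using closing snoc Nil ne by simp
      ultimately show ?thesis
        using that ay sym by blast
    next
      case (Cons b qs')
      have "a \<noteq> b"
        using dist snoc Cons by auto
      moreover have "?E y b"
        using succ Cons by (simp add: successively_append_iff)
      ultimately show ?thesis
        using that ay sym by blast
    qed
  qed
qed

lemma tree_graph_add_leaf:
  assumes T: "tree_graph T" and x: "x \<in> vertices T" and y: "y \<notin> vertices T"
  shows "tree_graph (insert y (vertices T), insert {x, y} (edges T))" (is "tree_graph ?T'")
proof -
  have sg: "simple_graph T" and conn: "connected_graph T" and acyc: "\<nexists>xs. cycle_in T xs"
    using T by (auto simp: tree_graph_def)
  have walk': "walk ?T' xs" if "walk T xs" for xs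
    using that by (rule walk_mono) auto
  have "simple_graph ?T'"
    using sg x y by (auto simp: simple_graph_def card_2_iff)
  moreover have "connected_graph ?T'"
    unfolding connected_graph_def
  proof (intro conjI ballI)
    fix u v assume uv: "u \<in> vertices ?T'" "v \<in> vertices ?T'"
    have ex: "\<exists>xs. walk T xs \<and> hd xs = a \<and> last xs = b" if "a \<in> vertices T" "b \<in> vertices T" for a b
      using conn that by (auto simp: connected_graph_def)
    have ne: "xs \<noteq> []" if "walk T xs" for xs
      using that by (simp add: walk_def)
    consider "u \<in> vertices T" "v \<in> vertices T" | "u \<in> vertices T" "v = y"
      | "u = y" "v \<in> vertices T" | "u = y" "v = y"
      using uv by auto
    then show "\<exists>xs. walk ?T' xs \<and> hd xs = u \<and> last xs = v"
    proof cases
      case 1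
      then show ?thesis using ex walk' by blast
    next
      case 2
      then obtain xs where "walk T xs" "hd xs = u" "last xs = x"
        using ex x by blast
      then show ?thesis
        using walk_snoc[OF walk', of xs y] ne 2 by (intro exI[of _ "xs @ [y]"]) auto
    next
      case 3
      then obtain xs where "walk T xs" "hd xs = x" "last xs = v"
        using ex x by blast
      then show ?thesis
        using walk_Cons[OF walk', of xs y] ne 3
        by (intro exI[of _ "y # xs"]) (auto simp: insert_commute)
    next
      case 4
      then show ?thesis
        by (intro exI[of _ "[y]"]) (auto simp: walk_def)
    qed
  qed simp
  moreover have "\<not> cycle_in ?T' xs" for xs
  proof
    assume cyc: "cycle_in ?T' xs"
    have old: "{a, b} \<in> edges T" if "{a, b} \<in> edges ?T'" "a \<noteq> y" "b \<noteq> y" for a b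
      using that by (auto simp: doubleton_eq_iff)
    have only_x: "a = x" if "{a, y} \<in> edges ?T'" for a
      using that sg y by (auto simp: doubleton_eq_iff simple_graph_def)
    show False
    proof (cases "y \<in> set xs")
      case True
      then show False
        using cycle_in_two_neighbours[OF cyc] only_x by metis
    next
      case False
      have "successively (\<lambda>u v. {u, v} \<in> edges T) xs"
        by (rule successively_mono[where P = "\<lambda>u v. {u, v} \<in> edges ?T'"])
          (use cyc False old in \<open>auto simp: cycle_in_def walk_def\<close>)
      moreover have "xs \<noteq> []" "{last xs, hd xs} \<in> edges ?T'"
        using cyc by (auto simp: cycle_in_def walk_def)
      then have "{last xs, hd xs} \<in> edges T"
        using False by (intro old) auto
      ultimately have "cycle_in T xs"
        using cyc False by (auto simp: cycle_in_def walk_def)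
      then show False
        using acyc by blast
    qed
  qed
  ultimately show ?thesis
    by (simp add: tree_graph_def)
qed

text \<open>The classes are the components of colour \<open>i\<close>. By reflexivity a vertex
  without edges of colour \<open>i\<close> is a component of its own, in line with single-vertex
  trees.\<close>

definition colour_connected :: "'a ugraph \<Rightarrow> ('a set \<Rightarrow> nat set) \<Rightarrow> nat \<Rightarrow> 'a \<Rightarrow> 'a \<Rightarrow> bool" where
  "colour_connected G \<phi> i = (\<lambda>u v. {u, v} \<in> edges G \<and> i \<in> \<phi> {u, v})\<^sup>*\<^sup>*"

lemma colour_connected_edge:
  "{u, v} \<in> edges G \<Longrightarrow> i \<in> \<phi> {u, v} \<Longrightarrow> colour_connected G \<phi> i u v"
  by (simp add: colour_connected_def r_into_rtranclp)

lemma colour_connected_trans: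
  "colour_connected G \<phi> i u v \<Longrightarrow> colour_connected G \<phi> i v w \<Longrightarrow> colour_connected G \<phi> i u w"
  by (simp add: colour_connected_def)

lemma colour_connected_sym:
  assumes "colour_connected G \<phi> i u v" shows "colour_connected G \<phi> i v u"
proof -
  have "symp (\<lambda>u v. {u, v} \<in> edges G \<and> i \<in> \<phi> {u, v})"
    by (auto intro!: sympI simp: insert_commute)
  then show ?thesis
    using sympD[OF symp_rtranclp] assms unfolding colour_connected_def by fast
qed

text \<open>A tree of colour \<open>i\<close> through \<open>v\<close> with the most vertices spans
  the component: otherwise an edge of colour \<open>i\<close> leaves it and supplies a new
  leaf.\<close>

lemma ex_spanning_tree_of_component:
  assumes G: "simple_graph G" and v: "v \<in> vertices G"
  obtains T where "is_subgraph T G" "tree_graph T" "monochromatic \<phi> T"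
    "vertices T = {y. colour_connected G \<phi> i v y}"
proof -
  define Q where "Q T \<longleftrightarrow> is_subgraph T G \<and> tree_graph T \<and> v \<in> vertices T \<and>
    vertices T \<subseteq> {y. colour_connected G \<phi> i v y} \<and> (\<forall>e\<in>edges T. i \<in> \<phi> e)" for T
  have fin: "finite (vertices G)"
    using G by (simp add: simple_graph_def)
  have "Q ({v}, {})"
    using v by (auto simp: Q_def tree_graph_singleton is_subgraph_def simple_graph_def
        colour_connected_def)
  moreover have "card (vertices T) < Suc (card (vertices G))" if "Q T" for T
    using that fin by (auto simp: Q_def is_subgraph_def less_Suc_eq_le intro: card_mono)
  ultimately obtain T where T: "Q T" and max: "\<And>T'. Q T' \<Longrightarrow> card (vertices T') \<le> card (vertices T)"
    using ex_has_greatest_nat[of Q "({v}, {})" "\<lambda>T. card (vertices T)" "Suc (card (vertices G))"]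
    by metis
  have finT: "finite (vertices T)"
    using T fin by (auto simp: Q_def is_subgraph_def intro: finite_subset)
  have "y \<in> vertices T" if "colour_connected G \<phi> i v y" for y
    using that unfolding colour_connected_def
  proof (induction rule: rtranclp_induct)
    case base
    then show ?case using T by (simp add: Q_def)
  next
    case (step x y)
    show ?case
    proof (rule ccontr)
      assume y: "y \<notin> vertices T"
      let ?T' = "(insert y (vertices T), insert {x, y} (edges T))"
      have tree: "tree_graph ?T'"
        using tree_graph_add_leaf[OF _ step.IH y] T by (simp add: Q_def)
      have "{x, y} \<subseteq> vertices G"
        using step.hyps(2) G by (auto simp: simple_graph_def)
      then have "is_subgraph ?T' G"
        using T tree step.hyps(2) by (auto simp: Q_def is_subgraph_def tree_graph_def)
      moreover have "colour_connected G \<phi> i v y"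
        using step.hyps by (auto simp: colour_connected_def intro: rtranclp.rtrancl_into_rtrancl)
      ultimately have "Q ?T'"
        using T tree step.hyps(2) by (auto simp: Q_def)
      then show False
        using max[of ?T'] y finT by simp
    qed
  qed
  then have "vertices T = {y. colour_connected G \<phi> i v y}"
    using T by (auto simp: Q_def)
  then show ?thesis
    using that[of T] T by (auto simp: Q_def monochromatic_def)
qed

text \<open>From here on, covering means choosing pairs of a vertex and a colour. Different pairs
  may give the same tree, which only lowers the count.\<close>

lemma tc_le_card_components:
  assumes G: "simple_graph G" and P: "finite P" "fst ` P \<subseteq> vertices G"
    and cover: "\<And>y. y \<in> vertices G \<Longrightarrow> \<exists>(v, i)\<in>P. colour_connected G \<phi> i v y"
  shows "tc G \<phi> \<le> card P"
proof -
  define good where "good p T \<longleftrightarrow> is_subgraph T G \<and> tree_graph T \<and> monochromatic \<phi> T \<and>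
    vertices T = {y. colour_connected G \<phi> (snd p) (fst p) y}" for p T
  have "\<exists>T. good p T" if "p \<in> P" for p
  proof -
    have "fst p \<in> vertices G" using P that by auto
    then obtain T where "is_subgraph T G" "tree_graph T" "monochromatic \<phi> T"
      "vertices T = {y. colour_connected G \<phi> (snd p) (fst p) y}"
      by (rule ex_spanning_tree_of_component[OF G])
    then show ?thesis unfolding good_def by blast
  qed
  then obtain t where t: "\<And>p. p \<in> P \<Longrightarrow> good p (t p)"
    by metis
  have "vertices G \<subseteq> (\<Union>T\<in>t ` P. vertices T)"
  proof
    fix y assume "y \<in> vertices G"
    then obtain v i where p: "(v, i) \<in> P" "colour_connected G \<phi> i v y"
      using cover by blast
    then have "y \<in> vertices (t (v, i))"
      using t[OF p(1)] by (simp add: good_def)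
    then show "y \<in> (\<Union>T\<in>t ` P. vertices T)"
      using p(1) by blast
  qed
  moreover have "vertices (t p) \<subseteq> vertices G" if "p \<in> P" for p
    using t[OF that] unfolding good_def is_subgraph_def by blast
  ultimately have "(\<Union>T\<in>t ` P. vertices T) = vertices G"
    by blast
  moreover have "is_subgraph T G \<and> tree_graph T \<and> monochromatic \<phi> T" if "T \<in> t ` P" for T
    using that t unfolding good_def by blast
  ultimately have "mono_tree_cover G \<phi> (t ` P)"
    using P(1) unfolding mono_tree_cover_def by simp
  then have "tc G \<phi> \<le> card (t ` P)"
    unfolding tc_def by (intro Least_le exI[of _ "t ` P"]) simp
  also have "\<dots> \<le> card P"
    using P by (intro card_image_le)
  finally show ?thesis .
qed

section \<open>Component covers of coloured complete bipartite graphs\<close>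

locale bipartite_colouring =
  fixes G :: "'a ugraph" and side :: "'a \<Rightarrow> bool" and \<phi> :: "'a set \<Rightarrow> nat set" and r k :: nat
  assumes simple: "simple_graph G"
    and edge_iff: "{u, v} \<in> edges G \<longleftrightarrow> u \<in> vertices G \<and> v \<in> vertices G \<and> side u \<noteq> side v"
    and colouring: "is_colouring r k G \<phi>"
    and has_edge: "edges G \<noteq> {}"
    and k_pos: "k \<ge> 1"
    and k_le: "k \<le> r"
begin

definition adj :: "'a \<Rightarrow> 'a \<Rightarrow> bool" where
  "adj u v \<longleftrightarrow> {u, v} \<in> edges G"

definition col :: "'a \<Rightarrow> 'a \<Rightarrow> nat set" where
  "col u v = \<phi> {u, v}"

text \<open>The restriction to \<open>{1..r}\<close> keeps the set finite: for \<open>u = v\<close>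
  every natural number would qualify.\<close>

definition common :: "'a \<Rightarrow> 'a \<Rightarrow> nat set" where
  "common u v = {i \<in> {1..r}. colour_connected G \<phi> i u v}"

lemma adj_iff: "adj u v \<longleftrightarrow> u \<in> vertices G \<and> v \<in> vertices G \<and> side u \<noteq> side v"
  by (simp add: adj_def edge_iff)

lemma adj_commute: "adj u v \<longleftrightarrow> adj v u"
  by (auto simp: adj_iff)

lemma col_commute: "col u v = col v u"
  by (simp add: col_def insert_commute)

lemma col_subset: "adj u v \<Longrightarrow> col u v \<subseteq> {1..r}"
  and card_col: "adj u v \<Longrightarrow> card (col u v) = k"
  using colouring by (auto simp: adj_def col_def is_colouring_def)

lemma finite_col: "adj u v \<Longrightarrow> finite (col u v)"
  by (rule finite_subset[OF col_subset]) auto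

lemma finite_common [simp]: "finite (common u v)"
  by (simp add: common_def)

lemma common_subset: "common u v \<subseteq> {1..r}"
  by (auto simp: common_def)

lemma common_commute: "common u v = common v u"
  using colour_connected_sym[of G \<phi> _ u v] colour_connected_sym[of G \<phi> _ v u]
  unfolding common_def by blast

lemma common_trans: "i \<in> common u v \<Longrightarrow> i \<in> common v w \<Longrightarrow> i \<in> common u w"
  using colour_connected_trans[of G \<phi> i u v w] by (simp add: common_def)

lemma col_connected: "adj u v \<Longrightarrow> i \<in> col u v \<Longrightarrow> colour_connected G \<phi> i u v"
  by (simp add: adj_def col_def colour_connected_edge)

lemma col_subset_common: "adj u v \<Longrightarrow> col u v \<subseteq> common u v"
  using col_subset col_connected unfolding common_def by blast

lemma ex_edge: obtains u v where "adj u v"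
proof -
  obtain e where e: "e \<in> edges G"
    using has_edge by blast
  then have "card e = 2"
    using simple by (simp add: simple_graph_def)
  then obtain u v where "e = {u, v}"
    by (auto simp: card_2_iff)
  then show ?thesis
    using that[of u v] e by (simp add: adj_def)
qed

lemma ex_adj: assumes "v \<in> vertices G" obtains u where "adj v u"
proof -
  obtain a b where "adj a b" by (rule ex_edge)
  then show ?thesis
    using assms that by (cases "side a = side v") (auto simp: adj_iff)
qed

text \<open>Two disjoint subsets of \<open>{1..r}\<close> have at most \<open>r\<close> elements
  together. So any \<open>r - k + 1\<close> colours at a vertex reach all its neighbours.\<close>

lemma meets_col:
  assumes "adj u v" "S \<subseteq> {1..r}" "card S + k > r"
  shows "S \<inter> col u v \<noteq> {}"
proof
  assume "S \<inter> col u v = {}"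
  then have "card (S \<union> col u v) = card S + k"
    using assms by (subst card_Un_disjoint) (auto simp: card_col finite_col intro: finite_subset)
  moreover have "card (S \<union> col u v) \<le> card {1..r}"
    using assms col_subset by (intro card_mono) auto
  ultimately show False
    using assms by simp
qed

text \<open>The colours in \<open>A\<close> contribute a single component to the stars at \<open>u\<close> and at \<open>v\<close>.\<close>

lemma tc_le_double_star:
  assumes uv: "adj u v" and S: "S \<subseteq> {1..r}" and T: "T \<subseteq> {1..r}"
    and A: "A \<subseteq> S" "A \<subseteq> T" "A \<subseteq> common u v"
    and covS: "\<And>y. adj u y \<Longrightarrow> S \<inter> col u y \<noteq> {}"
    and covT: "\<And>y. adj v y \<Longrightarrow> T \<inter> col v y \<noteq> {}"
  shows "tc G \<phi> + card A \<le> card S + card T"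
proof -
  let ?P = "Pair u ` S \<union> Pair v ` (T - A)"
  have fin: "finite S" "finite T" "finite A"
    using S T A by (auto intro: finite_subset)
  have "tc G \<phi> \<le> card ?P"
  proof (rule tc_le_card_components[OF simple])
    show "finite ?P" using fin by simp
    show "fst ` ?P \<subseteq> vertices G" using uv by (auto simp: adj_iff)
    fix y assume y: "y \<in> vertices G"
    show "\<exists>(w, i)\<in>?P. colour_connected G \<phi> i w y"
    proof (cases "side y = side u")
      case True
      then have vy: "adj v y" using uv y by (auto simp: adj_iff)
      then obtain i where i: "i \<in> T" "i \<in> col v y" using covT by blast
      have "colour_connected G \<phi> i v y"
        using vy i by (simp add: col_connected)
      moreover have "colour_connected G \<phi> i u v" if "i \<in> A"
        using A that by (auto simp: common_def)
      ultimately show ?thesis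
        using A i colour_connected_trans[of G \<phi> i u v y] by (cases "i \<in> A") auto
    next
      case False
      then have uy: "adj u y" using uv y by (auto simp: adj_iff)
      then obtain i where i: "i \<in> S" "i \<in> col u y" using covS by blast
      then show ?thesis using col_connected[OF uy] by auto
    qed
  qed
  also have "\<dots> \<le> card (Pair u ` S) + card (Pair v ` (T - A))"
    by (rule card_Un_le)
  also have "\<dots> \<le> card S + card (T - A)"
    using fin by (intro add_mono card_image_le) auto
  finally show ?thesis
    using fin A(2) card_mono[of T A] by (simp add: card_Diff_subset)
qed

text \<open>Here \<open>k \<ge> r - k + 1\<close>, so the chosen colours can all lie on the edge
  \<open>uv\<close>, and the two stars use the same components.\<close>

lemma tc_le_few:
  assumes "r < 2 * k"
  shows "tc G \<phi> \<le> r - k + 1"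
proof -
  obtain u v where uv: "adj u v" by (rule ex_edge)
  have "r - k + 1 \<le> card (col u v)"
    using assms k_le card_col[OF uv] by linarith
  then obtain S where S: "S \<subseteq> col u v" "card S = r - k + 1"
    by (rule obtain_subset_with_card_n)
  have Sr: "S \<subseteq> {1..r}" using S col_subset[OF uv] by blast
  have "tc G \<phi> + card S \<le> card S + card S"
    by (rule tc_le_double_star[OF uv Sr Sr])
      (use S Sr meets_col k_le col_subset_common[OF uv] in auto)
  then show ?thesis using S by simp
qed

text \<open>Any colour beyond the \<open>k\<close> of the edge \<open>uv\<close> that connects \<open>u\<close> and \<open>v\<close> saves a component.\<close>

lemma tc_le_common:
  assumes uv: "adj u v" and A: "A \<subseteq> common u v" "card A \<le> r - k + 1"
  shows "tc G \<phi> + card A \<le> 2 * (r - k + 1)"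
proof -
  have "A \<subseteq> {1..r}"
    using A(1) common_subset by blast
  then obtain S where S: "A \<subseteq> S" "S \<subseteq> {1..r}" "card S = r - k + 1"
    using exists_subset_between[of A "r - k + 1" "{1..r}"] A(2) k_pos k_le by fastforce
  have "tc G \<phi> + card A \<le> card S + card S"
    by (rule tc_le_double_star[OF uv S(2) S(2) S(1) S(1) A(1)])
      (use S meets_col k_le in auto)
  then show ?thesis using S by simp
qed

lemma tc_le_general:
  assumes "2 * k \<le> r"
  shows "tc G \<phi> + 3 * k \<le> 2 * r + 2"
proof -
  obtain u v where uv: "adj u v" by (rule ex_edge)
  have "tc G \<phi> + k \<le> 2 * (r - k + 1)"
    using tc_le_common[OF uv col_subset_common[OF uv]] assms card_col[OF uv] by simp
  then show ?thesis using k_le by simp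
qed

end

section \<open>Saving one component\<close>

text \<open>A colouring violating the bound \<open>2r - 3k + 1\<close>, written additively to avoid
  truncated subtraction. The consequences become contradictory once \<open>r < 3k\<close>.\<close>

locale extremal_colouring = bipartite_colouring +
  assumes two_k_le: "2 * k \<le> r"
    and tc_gt: "tc G \<phi> + 3 * k > 2 * r + 1"
begin

text \<open>An extra connecting colour gives \<open>k + 1 \<le> r - k + 1\<close> colours that count
  only once, which lowers the cover to \<open>2r - 3k + 1\<close>.\<close>

lemma common_eq_col:
  assumes uv: "adj u v"
  shows "common u v = col u v"
proof (rule ccontr)
  assume "common u v \<noteq> col u v"
  then obtain i where i: "i \<in> common u v" "i \<notin> col u v"
    using col_subset_common[OF uv] by blast
  have "card (insert i (col u v)) = k + 1"
    using i finite_col[OF uv] card_col[OF uv] by simp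
  then have "tc G \<phi> + (k + 1) \<le> 2 * (r - k + 1)"
    using tc_le_common[OF uv, of "insert i (col u v)"] i col_subset_common[OF uv] two_k_le by simp
  then show False using tc_gt k_le by simp
qed

text \<open>A path of colour \<open>i\<close> from \<open>u\<close> through \<open>w\<close> to
  \<open>w'\<close> puts \<open>i\<close> into \<open>common u w'\<close>, which equals
  \<open>col u w'\<close>. This is the complete bipartiteness of components.\<close>

lemma col_common_iff:
  assumes "adj u w" "adj u w'" "i \<in> common w w'"
  shows "i \<in> col u w \<longleftrightarrow> i \<in> col u w'"
  using assms common_trans common_commute common_eq_col by metis

lemma in_common_if_in_both:
  assumes "adj u w" "adj u w'" "i \<in> col u w" "i \<in> col u w'"
  shows "i \<in> common w w'"
  using assms common_trans common_commute common_eq_col by metis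

text \<open>Otherwise the star at \<open>v\<close> needs only the \<open>r - k\<close> colours outside \<open>X\<close>.\<close>

lemma ex_neighbour_of_disjoint_colour:
  assumes uv: "adj u v" and X: "X \<subseteq> {1..r}" "card X = k" "X \<inter> col u v = {}"
  shows "\<exists>x. adj v x \<and> col v x = X"
proof (rule ccontr)
  assume no: "\<nexists>x. adj v x \<and> col v x = X"
  have finX: "finite X" using finite_subset[OF X(1)] by simp
  obtain y where y: "y \<in> X" using X k_pos by fastforce
  \<comment> \<open>\<open>?T\<close> meets every \<open>k\<close>-set except \<open>X\<close>; at
    \<open>u\<close>, where \<open>X\<close> may occur, \<open>y\<close> is added. The total is
    \<open>(r - k + 1) + (r - k) - k = 2r - 3k + 1\<close>.\<close>
  let ?T = "{1..r} - X" and ?S = "insert y ({1..r} - X)"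
  have cT: "card ?T = r - k" using X finX by (simp add: card_Diff_subset)
  have cS: "card ?S = r - k + 1" using y cT by simp
  have "tc G \<phi> + card (col u v) \<le> card ?S + card ?T"
  proof (rule tc_le_double_star[OF uv])
    show S: "?S \<subseteq> {1..r}" using y X by auto
    show "?S \<inter> col u z \<noteq> {}" if "adj u z" for z
      using meets_col[OF that S] cS k_le by linarith
    show "?T \<inter> col v z \<noteq> {}" if z: "adj v z" for z
    proof
      assume "?T \<inter> col v z = {}"
      then have "col v z \<subseteq> X" using col_subset[OF z] by blast
      then have "col v z = X" using card_subset_eq[OF finX] X card_col[OF z] by simp
      then show False using no z by blast
    qed
  qed (use X col_subset[OF uv] col_subset_common[OF uv] in auto)
  then show False
    using card_col[OF uv] cT cS tc_gt k_le two_k_le by simp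
qed

subsection \<open>The case \<open>r = 2 * k\<close>\<close>

text \<open>
  The \<open>k\<close> components of an edge \<open>uv\<close> with colour set \<open>A\<close> miss only the sets \<open>X\<close> and \<open>Z\<close> of
  vertices joined to \<open>v\<close> and to \<open>u\<close> by the complement of \<open>A\<close>. All edges between \<open>X\<close> and \<open>Z\<close> have
  colour set \<open>A\<close>, so one further component covers both.
\<close>

lemma r_neq_double: "r \<noteq> 2 * k"
proof
  assume r: "r = 2 * k"
  obtain u v where uv: "adj u v" by (rule ex_edge)
  let ?A = "col u v"
  let ?B = "{1..r} - ?A"
  have cB: "card ?B = k"
    using r uv col_subset card_col finite_col by (simp add: card_Diff_subset)
  have B: "?B \<subseteq> {1..r}" "?B \<inter> ?A = {}" by auto
  obtain x where x: "adj v x" "col v x = ?B"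
    using ex_neighbour_of_disjoint_colour[OF uv B(1) cB B(2)] by blast
  obtain a where a: "a \<in> ?A" using card_col[OF uv] k_pos by fastforce
  have compl: "col p q = ?B" if "adj p q" "?A \<inter> col p q = {}" for p q
    using card_subset_eq[of ?B "col p q"] that cB col_subset card_col by fastforce
  \<comment> \<open>A colour in \<open>common u y\<close> would lie in both or in neither of
    \<open>?A\<close> and \<open>?B\<close>, which partition \<open>{1..r}\<close>.\<close>
  have no_common: "common u y = {}" if y: "adj v y" "col v y = ?B" for y
  proof -
    have "i \<notin> common u y" for i
    proof
      assume i: "i \<in> common u y"
      then have "i \<in> col v u \<longleftrightarrow> i \<in> col v y"
        using col_common_iff[of v u y i] uv y adj_commute by blast
      then show False using i y common_subset[of u y] col_commute[of u v] by auto
    qed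
    then show ?thesis by blast
  qed
  \<comment> \<open>The edges from \<open>z\<close> to \<open>u\<close> and to \<open>y\<close>
    share no colour by \<open>no_common\<close>, so the colour set of \<open>yz\<close> avoids
    \<open>?B\<close> and equals \<open>?A\<close>.\<close>
  have XZ: "a \<in> col y z" if y: "adj v y" "col v y = ?B" and z: "adj u z" "col u z = ?B" for y z
  proof (rule ccontr)
    have yz: "adj y z" using uv y(1) z(1) by (auto simp: adj_iff)
    assume "a \<notin> col y z"
    have "col z u \<inter> col z y = {}"
      using in_common_if_in_both[of z u y] no_common[OF y] yz z adj_commute by blast
    then have "col y z \<subseteq> ?A"
      using z(2) col_subset[OF yz] col_commute by blast
    then have "col y z = ?A"
      using card_subset_eq[OF finite_col[OF uv]] card_col uv yz by simp
    then show False using a \<open>a \<notin> col y z\<close> by simp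
  qed
  have vu: "adj v u" using uv adj_commute by blast
  have "?B \<inter> col v u = {}" using col_commute[of u v] by auto
  then obtain z where z: "adj u z" "col u z = ?B"
    using ex_neighbour_of_disjoint_colour[OF vu B(1) cB] by blast
  let ?P = "insert (x, a) (Pair u ` ?A)"
  have "tc G \<phi> \<le> card ?P"
  proof (rule tc_le_card_components[OF simple])
    show "finite ?P" using finite_col[OF uv] by simp
    show "fst ` ?P \<subseteq> vertices G" using uv x(1) by (auto simp: adj_iff)
    fix y assume y: "y \<in> vertices G"
    have aconn: "colour_connected G \<phi> a p q"
      if "adj v p" "col v p = ?B" "adj u q" "col u q = ?B" for p q
    proof -
      have "adj p q" using that(1,3) uv by (auto simp: adj_iff)
      then show ?thesis using XZ[OF that] col_connected by blast
    qed
    show "\<exists>(w, i)\<in>?P. colour_connected G \<phi> i w y"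
    proof (cases "side y = side u")
      case True
      then have vy: "adj v y" using uv y by (auto simp: adj_iff)
      show ?thesis
      proof (cases "?A \<inter> col v y = {}")
        case True
        then have "col v y = ?B" using compl vy by blast
        then have "colour_connected G \<phi> a x y"
          using aconn[OF x z] aconn[OF vy _ z] colour_connected_trans colour_connected_sym
          by metis
        then show ?thesis by auto
      next
        case False
        then obtain i where i: "i \<in> ?A" "i \<in> col v y" by blast
        then have "colour_connected G \<phi> i u y"
          using col_connected[OF uv] col_connected[OF vy] colour_connected_trans by metis
        then show ?thesis using i by auto
      qed
    next
      case False
      then have uy: "adj u y" using uv y by (auto simp: adj_iff)
      show ?thesis
      proof (cases "?A \<inter> col u y = {}")
        case True
        then show ?thesis using aconn[OF x uy] compl uy by auto
      next
        case False
        then show ?thesis using col_connected[OF uy] by auto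
      qed
    qed
  qed
  also have "\<dots> \<le> k + 1"
    using finite_col[OF uv] card_col[OF uv] card_image_le[of ?A "Pair u"]
    by (simp add: card_insert_if)
  finally show False using tc_gt r by simp
qed

subsection \<open>The case \<open>2 * k < r\<close>\<close>

text \<open>
  Two \<open>k\<close>-sets sharing \<open>k - 1\<close> elements are both disjoint from a third one, so the neighbours of
  \<open>v\<close> realise all \<open>k\<close>-sets: the Kneser graph is connected.
\<close>

lemma ex_neighbour_of_colour:
  assumes v: "v \<in> vertices G" and X: "X \<subseteq> {1..r}" "card X = k"
  shows "\<exists>x. adj v x \<and> col v x = X"
proof -
  have gt: "2 * k < r" using two_k_le r_neq_double by simp
  have step: "\<exists>y. adj v y \<and> col v y = Y"
    if "adj v x" "Y \<subseteq> {1..r}" "card Y = k" "Y \<inter> col v x = {}" for x Y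
    using ex_neighbour_of_disjoint_colour[of x v Y] that adj_commute col_commute by metis
  have finX: "finite X" using finite_subset[OF X(1)] by simp
  obtain u where "adj v u" using ex_adj[OF v] .
  then show ?thesis
  proof (induction "card (X - col v u)" arbitrary: u)
    case 0
    then have "X \<subseteq> col v u" using finX by simp
    then have "X = col v u"
      using card_subset_eq[of "col v u" X] finite_col card_col X 0 by simp
    then show ?case using 0 by blast
  next
    case (Suc d)
    let ?A = "col v u"
    have A: "finite ?A" "card ?A = k" "?A \<subseteq> {1..r}"
      using Suc.prems finite_col card_col col_subset by auto
    obtain x where x: "x \<in> X" "x \<notin> ?A"
      using Suc.hyps(2) by (metis Diff_iff card.empty ex_in_conv nat.distinct(1))
    have "\<not> ?A \<subseteq> X"
      using card_subset_eq[OF finX] A X x by auto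
    then obtain a where a: "a \<in> ?A" "a \<notin> X" by blast
    \<comment> \<open>One exchange moves the colour set closer to \<open>X\<close>. As
      \<open>2k < r\<close>, there are \<open>k\<close> colours outside \<open>insert x ?A\<close>;
      they form a set disjoint from both \<open>?A\<close> and \<open>?A'\<close>, so two steps lead
      from one to the other.\<close>
    let ?A' = "insert x (?A - {a})"
    have cA': "card ?A' = k" using A a x k_pos by simp
    have "card ({1..r} - insert x ?A) = r - (k + 1)"
      using A x X by (subst card_Diff_subset) auto
    then have "k \<le> card ({1..r} - insert x ?A)"
      using gt by linarith
    then obtain Y where Y: "Y \<subseteq> {1..r} - insert x ?A" "card Y = k"
      by (rule obtain_subset_with_card_n)
    obtain y where y: "adj v y" "col v y = Y"
      using step[OF Suc.prems, of Y] Y by blast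
    obtain z where z: "adj v z" "col v z = ?A'"
      using step[OF y(1), of ?A'] y Y cA' A x X by blast
    have "X - ?A' = (X - ?A) - {x}" using a by auto
    then have "card (X - ?A') = d" using Suc.hyps(2) x finX by simp
    then show ?case using Suc.hyps(1)[of z] z by simp
  qed
qed

text \<open>For a common neighbour \<open>z\<close>, the sets \<open>col z w\<close> and
  \<open>col z w'\<close> agree on \<open>common w w'\<close> and are disjoint off it. If
  \<open>col z w\<close> can be chosen off it, all three sets are pairwise disjoint. Otherwise let
  \<open>col z w\<close> contain its complement: equal sizes force agreement off it too, a
  contradiction.\<close>

lemma card_common_le:
  assumes w: "w \<in> vertices G" "w' \<in> vertices G" "side w = side w'"
    and ne: "common w w' \<noteq> {1..r}"
  shows "card (common w w') + 2 * k \<le> r"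
proof -
  let ?D = "common w w'"
  have D: "?D \<subseteq> {1..r}" "finite ?D" using common_subset by auto
  have edge: "\<exists>z. adj z w \<and> adj z w' \<and> col z w = E" if E: "E \<subseteq> {1..r}" "card E = k" for E
  proof -
    obtain z where z: "adj w z" "col w z = E"
      using ex_neighbour_of_colour[OF w(1) E] by blast
    then have "adj z w" "adj z w'"
      using w by (simp_all add: adj_iff)
    then show ?thesis
      using z(2) col_commute by metis
  qed
  have cD: "card ({1..r} - ?D) = r - card ?D"
    using D by (simp add: card_Diff_subset)
  show ?thesis
  proof (cases "card ?D + k \<le> r")
    case True
    then have "k \<le> card ({1..r} - ?D)"
      using cD by linarith
    then obtain E where E: "E \<subseteq> {1..r} - ?D" "card E = k"
      by (rule obtain_subset_with_card_n)
    obtain z where z: "adj z w" "adj z w'" "col z w = E"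
      using edge[of E] E by blast
    have 1: "E \<inter> col z w' = {}"
      using in_common_if_in_both[OF z(1,2)] z(3) E by blast
    have 2: "(E \<union> col z w') \<inter> ?D = {}"
      using col_common_iff[OF z(1,2)] z(3) E by blast
    have fin: "finite E" "finite (col z w')"
      using z finite_col by auto
    have "card (E \<union> col z w' \<union> ?D) = 2 * k + card ?D"
      using 1 2 fin D E z card_col by (simp add: card_Un_disjoint)
    moreover have "card (E \<union> col z w' \<union> ?D) \<le> card {1..r}"
      using E D col_subset[OF z(2)] by (intro card_mono) auto
    ultimately show ?thesis by simp
  next
    case False
    then have "card ({1..r} - ?D) \<le> k"
      using cD by linarith
    then obtain E where E: "{1..r} - ?D \<subseteq> E" "E \<subseteq> {1..r}" "card E = k"
      using exists_subset_between[of "{1..r} - ?D" k "{1..r}"] k_le by fastforce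
    obtain z where z: "adj z w" "adj z w'" "col z w = E"
      using edge[of E] E by blast
    let ?E' = "col z w'"
    have fin: "finite E" "finite ?E'"
      using z finite_col by auto
    have eq: "?E' \<inter> ?D = E \<inter> ?D"
      using col_common_iff[OF z(1,2)] z(3) by blast
    have "card ?E' = card E"
      using card_col[OF z(2)] E by simp
    then have "card (?E' - ?D) = card (E - ?D)"
      using eq fin by (simp add: card_Diff_subset_Int)
    moreover have "?E' - ?D \<subseteq> E - ?D"
      using col_subset[OF z(2)] E by blast
    ultimately have "?E' - ?D = E - ?D"
      using card_subset_eq[of "E - ?D"] fin by simp
    moreover have "E - ?D \<noteq> {}"
      using E ne D by blast
    ultimately obtain j where "j \<in> E" "j \<in> ?E'" "j \<notin> ?D" by blast
    then show ?thesis
      using in_common_if_in_both[OF z(1,2)] z(3) by blast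
  qed
qed

text \<open>
  Neighbours \<open>w1, w2, w3\<close> of \<open>v\<close> whose colour sets cover \<open>{1..r}\<close> and have empty intersection have
  no common component. A further vertex \<open>z\<close>, with the colours of \<open>zw3\<close> chosen to contain
  \<open>common w1 w2\<close> and to avoid the other two common sets, then sees three pairwise disjoint
  \<open>k\<close>-sets.
\<close>

lemma three_k_le: "3 * k \<le> r"
proof (rule ccontr)
  assume "\<not> 3 * k \<le> r"
  then have big: "r < 3 * k" by simp
  have gt: "2 * k < r" using two_k_le r_neq_double by simp
  obtain v where v: "v \<in> vertices G"
    using ex_edge by (auto simp: adj_iff)
  have "k \<le> card {1..r}"
    using k_le by simp
  then obtain A1 where A1: "A1 \<subseteq> {1..r}" "card A1 = k" "finite A1"
    by (rule obtain_subset_with_card_n)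
  have c1: "card ({1..r} - A1) = r - k"
    using A1 by (simp add: card_Diff_subset)
  have "k \<le> card ({1..r} - A1)"
    using c1 two_k_le by linarith
  then obtain A2 where A2: "A2 \<subseteq> {1..r} - A1" "card A2 = k" "finite A2"
    by (rule obtain_subset_with_card_n)
  have c2: "card ({1..r} - A1 - A2) = r - k - k"
    using A2 c1 by (simp add: card_Diff_subset)
  have "card ({1..r} - A1 - A2) \<le> k"
    using c2 big by linarith
  then obtain A3 where A3: "{1..r} - A1 - A2 \<subseteq> A3" "A3 \<subseteq> {1..r}" "card A3 = k"
    using exists_subset_between[of "{1..r} - A1 - A2" k "{1..r}"] k_le by fastforce
  \<comment> \<open>As \<open>2k < r\<close>, some colour \<open>b\<close> lies in \<open>A3\<close>
    only; it will separate \<open>w3\<close> from \<open>w1\<close> and \<open>w2\<close>, so that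
    \<open>card_common_le\<close> applies.\<close>
  have "card ({1..r} - A1 - A2) \<noteq> 0"
    using c2 gt by linarith
  then obtain b where "b \<in> {1..r} - A1 - A2"
    by (metis card.empty ex_in_conv)
  then have b: "b \<in> A3" "b \<notin> A1" "b \<notin> A2"
    using A3(1) by blast+
  obtain w1 where w1: "adj v w1" "col v w1 = A1" using ex_neighbour_of_colour[OF v] A1 by blast
  obtain w2 where w2: "adj v w2" "col v w2 = A2" using ex_neighbour_of_colour[OF v] A2 by blast
  obtain w3 where w3: "adj v w3" "col v w3 = A3" using ex_neighbour_of_colour[OF v] A3 by blast
  have vert: "w1 \<in> vertices G" "w2 \<in> vertices G" "w3 \<in> vertices G"
    and side: "side w1 = side w2" "side w1 = side w3" "side w2 = side w3"
    using w1 w2 w3 by (auto simp: adj_iff)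
  let ?D12 = "common w1 w2" and ?D13 = "common w1 w3" and ?D23 = "common w2 w3"
  have i12: "i \<in> A1 \<longleftrightarrow> i \<in> A2" if "i \<in> ?D12" for i
    using col_common_iff[OF w1(1) w2(1) that] w1 w2 by simp
  have i13: "i \<in> A1 \<longleftrightarrow> i \<in> A3" if "i \<in> ?D13" for i
    using col_common_iff[OF w1(1) w3(1) that] w1 w3 by simp
  have i23: "i \<in> A2 \<longleftrightarrow> i \<in> A3" if "i \<in> ?D23" for i
    using col_common_iff[OF w2(1) w3(1) that] w2 w3 by simp
  have br: "b \<in> {1..r}" using b A3 by blast
  obtain a where a: "a \<in> A1" using A1 k_pos by fastforce
  have "a \<in> {1..r}" "a \<notin> A2" using a A1 A2 by auto
  then have "?D12 \<noteq> {1..r}" using i12 a by blast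
  then have c12: "card ?D12 + 2 * k \<le> r" using card_common_le vert side by blast
  have "?D13 \<noteq> {1..r}" using i13 b br by blast
  then have c13: "card ?D13 + 2 * k \<le> r" using card_common_le vert side by blast
  have "?D23 \<noteq> {1..r}" using i23 b br by blast
  then have c23: "card ?D23 + 2 * k \<le> r" using card_common_le vert side by blast
  \<comment> \<open>Such a colour would lie in all of \<open>A1\<close>, \<open>A2\<close>,
    \<open>A3\<close> or in none, but \<open>A1\<close> and \<open>A2\<close> are disjoint and the
    three sets cover \<open>{1..r}\<close>.\<close>
  have no3: False if i: "i \<in> ?D13" "i \<in> ?D23" for i
  proof -
    have "i \<in> ?D12" using i common_trans common_commute by metis
    then show False
      using i i12 i13 i23 A1 A2 A3 common_subset by blast
  qed
  have disj: "?D12 \<inter> (?D13 \<union> ?D23) = {}"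
    using no3 common_trans[of _ w2 w1 w3] common_trans[of _ w1 w2 w3] common_commute[of w1 w2]
    by blast
  \<comment> \<open>Both sets have at most \<open>r - 2k\<close> colours, so at least
    \<open>4k - r\<close> remain, more than \<open>k\<close> because \<open>r < 3k\<close>.\<close>
  have "card (?D13 \<union> ?D23) \<le> card ?D13 + card ?D23"
    by (rule card_Un_le)
  then have "k \<le> r - card (?D13 \<union> ?D23)"
    using c13 c23 big by linarith
  also have "\<dots> = card ({1..r} - (?D13 \<union> ?D23))"
    using common_subset by (subst card_Diff_subset) auto
  finally have avail: "k \<le> card ({1..r} - (?D13 \<union> ?D23))" .
  have "?D12 \<subseteq> {1..r} - (?D13 \<union> ?D23)"
    using disj common_subset by blast
  moreover have "card ?D12 \<le> k"
    using c12 big by linarith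
  ultimately obtain E where E: "?D12 \<subseteq> E" "E \<subseteq> {1..r} - (?D13 \<union> ?D23)" "card E = k"
    using exists_subset_between[of ?D12 k "{1..r} - (?D13 \<union> ?D23)"] avail
    by blast
  obtain z where z3: "adj z w3" "col z w3 = E"
    using ex_neighbour_of_colour[OF vert(3)] E adj_commute col_commute by (metis Diff_subset subset_trans)
  have z1: "adj z w1" and z2: "adj z w2"
    using z3 vert side by (auto simp: adj_iff)
  let ?E1 = "col z w1" and ?E2 = "col z w2"
  have d13: "?E1 \<inter> E = {}" using in_common_if_in_both[OF z1 z3(1)] z3 E by blast
  have d23: "?E2 \<inter> E = {}" using in_common_if_in_both[OF z2 z3(1)] z3 E by blast
  \<comment> \<open>A colour in both would lie in \<open>?D12\<close>, hence in \<open>E\<close>,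
    which is disjoint from \<open>?E1\<close>.\<close>
  have d12: "?E1 \<inter> ?E2 = {}" using in_common_if_in_both[OF z1 z2] d13 E by blast
  have fin: "finite ?E1" "finite ?E2" "finite E"
    using z1 z2 z3 finite_col by auto
  have "card (?E1 \<union> ?E2 \<union> E) = 3 * k"
    using d13 d23 d12 fin E card_col[OF z1] card_col[OF z2]
    by (simp add: card_Un_disjoint Int_Un_distrib2)
  moreover have "card (?E1 \<union> ?E2 \<union> E) \<le> card {1..r}"
    using col_subset[OF z1] col_subset[OF z2] E by (intro card_mono) auto
  ultimately show False using big by simp
qed

end

section \<open>The three ranges of \<open>k\<close>\<close>

lemma (in bipartite_colouring) tc_le_save_one:
  assumes "2 * k \<le> r" "r < 3 * k"
  shows "tc G \<phi> + 3 * k \<le> 2 * r + 1"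
proof (rule ccontr)
  assume "\<not> ?thesis"
  then interpret extremal_colouring G side \<phi> r k
    using assms by unfold_locales auto
  show False using three_k_le assms by simp
qed

theorem theorem1p5:
  fixes r k n m :: nat
  assumes "r \<ge> 1" and "k \<ge> 1" and "n \<ge> 1" and "m \<ge> 1" and "r \<ge> k"
  shows "int (tree_cover_number r k (complete_bipartite n m)) \<le>
    (if real k \<ge> real r / 2 then int r - int k + 1
     else if real r / 2 > real k \<and> real k \<ge> 2 * real r / 5 then 2 * int r - 3 * int k + 1
     else 2 * int r - 3 * int k + 2)"
proof -
  let ?G = "complete_bipartite n m"
  have loc: "bipartite_colouring ?G isl \<phi> r k" if "is_colouring r k ?G \<phi>" for \<phi>
  proof
    show "simple_graph ?G" by (rule simple_graph_complete_bipartite)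
    show "{u, v} \<in> edges ?G \<longleftrightarrow> u \<in> vertices ?G \<and> v \<in> vertices ?G \<and> isl u \<noteq> isl v" for u v
      by (cases u; cases v) (auto simp: complete_bipartite_def doubleton_eq_iff)
    have "{Inl 0, Inr 0} \<in> edges ?G"
      using assms unfolding complete_bipartite_def by fastforce
    then show "edges ?G \<noteq> {}" by blast
  qed (use assms that in auto)
  have tcn: "tree_cover_number r k ?G \<le> M" if "\<And>\<phi>. is_colouring r k ?G \<phi> \<Longrightarrow> tc ?G \<phi> \<le> M" for M
  proof -
    have "\<forall>\<phi>. is_colouring r k ?G \<phi> \<longrightarrow> tc ?G \<phi> \<le> M"
      using that by simp
    then show ?thesis
      unfolding tree_cover_number_def by (rule Least_le)
  qed
  \<comment> \<open>The boundary \<open>r = 2k\<close> is treated with the second range, since there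
    \<open>2r - 3k + 1 = r - k + 1\<close>.\<close>
  consider "r < 2 * k" | "2 * k \<le> r" "2 * r \<le> 5 * k" | "5 * k < 2 * r"
    by linarith
  then show ?thesis
  proof cases
    case 1
    then have "tree_cover_number r k ?G \<le> r - k + 1"
      by (intro tcn bipartite_colouring.tc_le_few[OF loc])
    then show ?thesis using 1 assms by simp
  next
    case 2
    have "tc ?G \<phi> \<le> 2 * r + 1 - 3 * k" if "is_colouring r k ?G \<phi>" for \<phi>
      using bipartite_colouring.tc_le_save_one[OF loc[OF that]] 2 assms by simp
    then have "tree_cover_number r k ?G \<le> 2 * r + 1 - 3 * k"
      by (rule tcn)
    then have "int (tree_cover_number r k ?G) \<le> 2 * int r - 3 * int k + 1"
      using 2 by linarith
    then show ?thesis using 2 by auto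
  next
    case 3
    have "tc ?G \<phi> \<le> 2 * r + 2 - 3 * k" if "is_colouring r k ?G \<phi>" for \<phi>
      using bipartite_colouring.tc_le_general[OF loc[OF that]] 3 by simp
    then have "tree_cover_number r k ?G \<le> 2 * r + 2 - 3 * k"
      by (rule tcn)
    then have "int (tree_cover_number r k ?G) \<le> 2 * int r - 3 * int k + 2"
      using 3 by linarith
    then show ?thesis using 3 by auto
  qed
qed

end
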